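(* Let $M\subseteq\mathbb{R}^d$ be a (free) $\mathbb{Z}$-module spanning $\mathbb{R}^d$. Then $\mathrm{OS}(M)=\{R\in\mathrm{O}(d,\mathbb{R})\mid \exists\,\alpha\in\mathbb{R}^+ \text{ with } \alpha RM\subseteq M\}$ is a subgroup of $\mathrm{O}(d,\mathbb{R})$.
   Context: A (free) $\mathbb{Z}$-module of rank $k$ in dimension $d$ is a set $M=\langle t_1,\dots,t_k\rangle_{\mathbb{Z}}=\{n_1t_1+\dots+n_kt_k\mid n_i\in\mathbb{Z}\}$ where $t_1,\dots,t_k\in\mathbb{R}^d$ are rationally independent and span $\mathbb{R}^d$ over $\mathbb{R}$. *)

theory Defs
  imports "HOL-Analysis.Analysis" "HOL-Algebra.Group"
begin

definition orthogonal_group :: "(real^'d^'d) monoid" where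
  "orthogonal_group = \<lparr>carrier = {R. orthogonal_matrix R}, mult = (**), one = mat 1\<rparr>"

lemma group_orthogonal_group: "group (orthogonal_group :: (real^'d^'d) monoid)"
proof (rule groupI)
  fix R :: "real^'d^'d"
  assume "R \<in> carrier orthogonal_group"
  then show "\<exists>S\<in>carrier orthogonal_group. S \<otimes>\<^bsub>orthogonal_group\<^esub> R = \<one>\<^bsub>orthogonal_group\<^esub>"
    by (intro bexI[of _ "transpose R"]) (auto simp: orthogonal_group_def orthogonal_matrix_def)
qed (auto simp: orthogonal_group_def orthogonal_matrix_mul orthogonal_matrix_id matrix_mul_assoc)

definition rationally_independent :: "nat \<Rightarrow> (nat \<Rightarrow> 'a::real_vector) \<Rightarrow> bool" where
  "rationally_independent k t \<longleftrightarrow>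
     (\<forall>q :: nat \<Rightarrow> rat. (\<Sum>i=1..k. of_rat (q i) *\<^sub>R t i) = 0 \<longrightarrow> (\<forall>i\<in>{1..k}. q i = 0))"

definition int_combinations :: "nat \<Rightarrow> (nat \<Rightarrow> 'a::real_vector) \<Rightarrow> 'a set" where
  "int_combinations k t = {\<Sum>i=1..k. of_int (n i) *\<^sub>R t i | n :: nat \<Rightarrow> int. True}"

definition free_Z_module :: "nat \<Rightarrow> (real^'d) set \<Rightarrow> bool" where
  "free_Z_module k M \<longleftrightarrow>
     (\<exists>t :: nat \<Rightarrow> real^'d. rationally_independent k t \<and> span (t ` {1..k}) = UNIV \<and>
        M = int_combinations k t)"

definition OS :: "(real^'d) set \<Rightarrow> (real^'d^'d) set" where
  "OS M = {R \<in> carrier orthogonal_group. \<exists>\<alpha>::real. \<alpha> > 0 \<and> (\<lambda>x. \<alpha> *\<^sub>R (R *v x)) ` M \<subseteq> M}"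

end

theory Submission imports Defs begin

text \<open>
  The only nontrivial point is closure under inverses. If \<open>A = \<alpha> R\<close> maps \<open>M\<close> into itself, then
  \<open>A\<close> is an injective rational-linear endomorphism of the rational span of \<open>M\<close>, which is
  finite-dimensional, so \<open>A\<close> is also surjective there. Clearing denominators gives a positive
  integer \<open>m\<close> with \<open>m M \<subseteq> A M\<close>, i.e. \<open>(m / \<alpha>) R\<inverse> M \<subseteq> M\<close>.
\<close>

section \<open>Rational linear algebra inside a real vector space\<close>

text \<open>The built-in scaling of a real vector space is by reals. Restricting scalars to the
  rationals needs a scaling function of its own, so that spans, independence and dimension bounds
  can be taken over the rationals.\<close>

definition rat_scale :: "rat \<Rightarrow> 'a::real_vector \<Rightarrow> 'a" where
  "rat_scale q x = of_rat q *\<^sub>R x"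

interpretation rat: vector_space_pair
  "rat_scale :: rat \<Rightarrow> 'a::real_vector \<Rightarrow> 'a" "rat_scale :: rat \<Rightarrow> 'a \<Rightarrow> 'a"
  by unfold_locales (simp_all add: rat_scale_def algebra_simps of_rat_add of_rat_mult)

lemma rat_linear_of_linear:
  assumes "linear f"
  shows "Vector_Spaces.linear rat_scale rat_scale f"
  using assms
  by unfold_locales (simp_all add: rat_scale_def linear_add linear_scale)

text \<open>Dimension count over the rationals: an injective linear map of a finite-dimensional
  space into itself is onto. It is phrased through spanning sets, so no subspace type is
  needed.\<close>

lemma rat_span_subset_span_image:
  fixes f :: "'a::real_vector \<Rightarrow> 'a"
  assumes "linear f" "inj f" "finite T" "f ` T \<subseteq> rat.vs1.span T"
  shows "T \<subseteq> rat.vs1.span (f ` T)"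
proof -
  \<comment> \<open>\<open>B\<close> is a rational basis of the span of \<open>T\<close>; its image
    under \<open>f\<close> is independent and has the same number of elements.\<close>
  obtain B where B: "B \<subseteq> T" "rat.vs1.independent B" "T \<subseteq> rat.vs1.span B"
    by (rule rat.vs1.maximal_independent_subset)
  have "finite B"
    using B(1) assms(3) finite_subset by blast
  have indep: "rat.vs1.independent (f ` B)"
    by (rule rat.linear_independent_injective_image[OF rat_linear_of_linear[OF assms(1)] B(2)])
      (rule inj_on_subset[OF assms(2)], simp)
  have card: "card (f ` B) = card B"
    by (rule card_image) (rule inj_on_subset[OF assms(2)], simp)
  have span: "rat.vs1.span T \<subseteq> rat.vs1.span B"
    by (rule rat.vs1.span_minimal[OF B(3) rat.vs1.subspace_span])
  have "x \<in> rat.vs1.span (f ` B)" if "x \<in> T" for x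
  proof (rule ccontr)
    assume x: "x \<notin> rat.vs1.span (f ` B)"
    then have "rat.vs1.independent (insert x (f ` B))"
      using indep by (rule rat.vs1.independent_insertI)
    moreover have "insert x (f ` B) \<subseteq> rat.vs1.span B"
      using that B(1,3) assms(4) span by blast
    ultimately have "card (insert x (f ` B)) \<le> card B"
      using rat.vs1.independent_span_bound[OF \<open>finite B\<close>, THEN conjunct2] by simp
    moreover have "x \<notin> f ` B"
      using x by (rule contrapos_nn) (rule rat.vs1.span_base)
    ultimately show False
      using \<open>finite B\<close> card by simp
  qed
  then show ?thesis
    using rat.vs1.span_mono[OF image_mono[OF B(1), of f]] by (intro subsetI) (rule subsetD)
qed

section \<open>Integer combinations and clearing of denominators\<close>

lemma int_combinations_add:
  assumes "x \<in> int_combinations k t" "y \<in> int_combinations k t"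
  shows "x + y \<in> int_combinations k t"
proof -
  obtain n n' :: "nat \<Rightarrow> int" where
    "x = (\<Sum>i=1..k. of_int (n i) *\<^sub>R t i)" "y = (\<Sum>i=1..k. of_int (n' i) *\<^sub>R t i)"
    using assms by (auto simp: int_combinations_def)
  then have "x + y = (\<Sum>i=1..k. of_int (n i + n' i) *\<^sub>R t i)"
    by (simp add: sum.distrib scaleR_left_distrib)
  then show ?thesis
    unfolding int_combinations_def by fast
qed

lemma int_combinations_scale:
  assumes "x \<in> int_combinations k t"
  shows "of_int c *\<^sub>R x \<in> int_combinations k t"
proof -
  obtain n :: "nat \<Rightarrow> int" where "x = (\<Sum>i=1..k. of_int (n i) *\<^sub>R t i)"
    using assms by (auto simp: int_combinations_def)
  then have "of_int c *\<^sub>R x = (\<Sum>i=1..k. of_int (c * n i) *\<^sub>R t i)"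
    by (simp add: scaleR_sum_right)
  then show ?thesis
    unfolding int_combinations_def by fast
qed

lemma int_combinations_zero: "0 \<in> int_combinations k t"
  unfolding int_combinations_def by (intro CollectI exI[of _ "\<lambda>_. 0"]) simp

lemma int_combinations_generator:
  assumes "i \<in> {1..k}"
  shows "t i \<in> int_combinations k t"
proof -
  have "(\<Sum>j=1..k. of_int (if j = i then 1 else 0) *\<^sub>R t j) = (\<Sum>j=1..k. if j = i then t j else 0)"
    by (rule sum.cong) auto
  also have "\<dots> = t i"
    using assms by simp
  finally have "t i = (\<Sum>j=1..k. of_int (if j = i then 1 else 0) *\<^sub>R t j)"
    by simp
  then show ?thesis
    unfolding int_combinations_def by fast
qed

lemma int_combinations_subset_rat_span:
  "int_combinations k t \<subseteq> rat.vs1.span (t ` {1..k})"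
proof
  fix x assume "x \<in> int_combinations k t"
  then obtain n :: "nat \<Rightarrow> int" where "x = (\<Sum>i=1..k. of_int (n i) *\<^sub>R t i)"
    by (auto simp: int_combinations_def)
  then have "x = (\<Sum>i=1..k. rat_scale (of_int (n i)) (t i))"
    by (simp add: rat_scale_def)
  also have "\<dots> \<in> rat.vs1.span (t ` {1..k})"
    by (intro rat.vs1.span_sum rat.vs1.span_scale rat.vs1.span_base) simp
  finally show "x \<in> rat.vs1.span (t ` {1..k})" .
qed

text \<open>A rational combination has finitely many denominators, removed one summand at a time.
  \<open>N\<close> is kept abstract because the set of interest is the image of a module under a
  linear map.\<close>

lemma rat_span_clear_denominator:
  fixes N :: "'a::real_vector set"
  assumes "x \<in> rat.vs1.span S" "S \<subseteq> N" "0 \<in> N"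
    and add: "\<And>x y. x \<in> N \<Longrightarrow> y \<in> N \<Longrightarrow> x + y \<in> N"
    and scale: "\<And>c x. x \<in> N \<Longrightarrow> of_int c *\<^sub>R x \<in> N"
  shows "\<exists>m::int. m > 0 \<and> of_int m *\<^sub>R x \<in> N"
  using assms(1)
proof (induction rule: rat.vs1.span_induct_alt)
  case base
  show ?case
    using assms(3) by (intro exI[of _ 1]) simp
next
  case (step q s y)
  then obtain m :: int where m: "m > 0" "of_int m *\<^sub>R y \<in> N"
    by blast
  obtain a b :: int where "quotient_of q = (a, b)"
    by (cases "quotient_of q")
  then have ab: "q = of_int a / of_int b" "b > 0"
    by (rule quotient_of_div, rule quotient_of_denom_pos)
  \<comment> \<open>The factor \<open>m\<close> handles the earlier summands and \<open>b\<close>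
    the denominator of the new coefficient; both are positive, hence so is the product.\<close>
  have "of_int (m * b) *\<^sub>R (rat_scale q s + y)
      = of_int (m * a) *\<^sub>R s + of_int b *\<^sub>R (of_int m *\<^sub>R y)"
    using ab by (simp add: rat_scale_def of_rat_divide algebra_simps)
  also have "\<dots> \<in> N"
    by (intro add scale m(2) subsetD[OF assms(2) step(1)])
  finally show ?case
    using m(1) ab(2) by (intro exI[of _ "m * b"]) simp
qed

lemma sum_in_closed:
  assumes "0 \<in> N" "\<And>x y. x \<in> N \<Longrightarrow> y \<in> N \<Longrightarrow> x + y \<in> N" "\<And>i. i \<in> I \<Longrightarrow> g i \<in> N"
  shows "sum g I \<in> N"
  using assms(3) by (induction I rule: infinite_finite_induct) (auto intro: assms(1,2))

text \<open>Surjectivity over the rationals becomes surjectivity over the integers up to one factor: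
  each generator needs its own multiplier, and finitely many multipliers have a common
  multiple.\<close>

lemma int_combinations_multiple_subset_image:
  fixes f :: "'a::real_vector \<Rightarrow> 'a" and t :: "nat \<Rightarrow> 'a" and k :: nat
  defines "M \<equiv> int_combinations k t"
  assumes f: "linear f" "inj f" "f ` M \<subseteq> M"
  shows "\<exists>m::int. m > 0 \<and> (\<forall>x\<in>M. of_int m *\<^sub>R x \<in> f ` M)"
proof -
  let ?T = "t ` {1..k}"
  have zero: "0 \<in> f ` M"
    using int_combinations_zero linear_0[OF f(1)] unfolding M_def by (metis image_eqI)
  have add: "x + y \<in> f ` M" if xy: "x \<in> f ` M" "y \<in> f ` M" for x y
  proof -
    obtain u v where "u \<in> M" "v \<in> M" "x = f u" "y = f v"
      using xy by blast
    then show ?thesis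
      using imageI[OF int_combinations_add[of u k t v], of f]
      by (simp add: M_def linear_add[OF f(1)])
  qed
  have scale: "of_int c *\<^sub>R x \<in> f ` M" if x: "x \<in> f ` M" for c x
  proof -
    obtain u where "u \<in> M" "x = f u"
      using x by blast
    then show ?thesis
      using imageI[OF int_combinations_scale[of u k t c], of f]
      by (simp add: M_def linear_scale[OF f(1)])
  qed
  have gens: "?T \<subseteq> M"
    using int_combinations_generator unfolding M_def by blast
  have "?T \<subseteq> rat.vs1.span (f ` ?T)"
  proof (rule rat_span_subset_span_image[OF f(1,2)])
    show "f ` ?T \<subseteq> rat.vs1.span ?T"
      using gens f(3) int_combinations_subset_rat_span[of k t] unfolding M_def by blast
  qed simp
  then have span: "t i \<in> rat.vs1.span (f ` ?T)" if "i \<in> {1..k}" for i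
    using that by blast
  have "\<exists>m::int. m > 0 \<and> of_int m *\<^sub>R t i \<in> f ` M" if "i \<in> {1..k}" for i
    by (rule rat_span_clear_denominator[OF span[OF that] image_mono[OF gens] zero add scale])
  then obtain m :: "nat \<Rightarrow> int"
    where m: "\<And>i. i \<in> {1..k} \<Longrightarrow> m i > 0 \<and> of_int (m i) *\<^sub>R t i \<in> f ` M"
    by metis
  \<comment> \<open>The product of the multipliers is an integer multiple of each
    \<open>m i\<close>, so it works for all generators at once.\<close>
  define p where "p = (\<Prod>i=1..k. m i)"
  have gen: "of_int p *\<^sub>R t i \<in> f ` M" if i: "i \<in> {1..k}" for i
  proof -
    have "p = (\<Prod>j\<in>{1..k} - {i}. m j) * m i"
      unfolding p_def using i by (simp add: prod.remove mult.commute)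
    then have "of_int p *\<^sub>R t i = of_int (\<Prod>j\<in>{1..k} - {i}. m j) *\<^sub>R (of_int (m i) *\<^sub>R t i)"
      by simp
    then show ?thesis
      by (simp only: scale m[OF i])
  qed
  have "of_int p *\<^sub>R x \<in> f ` M" if x: "x \<in> M" for x
  proof -
    obtain n :: "nat \<Rightarrow> int" where "x = (\<Sum>i=1..k. of_int (n i) *\<^sub>R t i)"
      using x unfolding M_def int_combinations_def by blast
    then have "of_int p *\<^sub>R x = (\<Sum>i=1..k. of_int (n i) *\<^sub>R (of_int p *\<^sub>R t i))"
      by (simp add: scaleR_sum_right mult.commute)
    also have "\<dots> \<in> f ` M"
      by (intro sum_in_closed zero add scale gen)
    finally show ?thesis .
  qed
  moreover have "p > 0"
    unfolding p_def by (rule prod_pos) (use m in blast)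
  ultimately show ?thesis
    by blast
qed

section \<open>The subgroup axioms\<close>

lemma OS_one: "mat 1 \<in> OS M"
  unfolding OS_def orthogonal_group_def
  by (auto simp: orthogonal_matrix_id intro!: exI[of _ "1::real"])

lemma OS_mult:
  assumes "R \<in> OS M" "S \<in> OS M"
  shows "R ** S \<in> OS M"
proof -
  obtain a b :: real where "a > 0" "b > 0"
    and a: "\<And>x. x \<in> M \<Longrightarrow> a *\<^sub>R (R *v x) \<in> M"
    and b: "\<And>x. x \<in> M \<Longrightarrow> b *\<^sub>R (S *v x) \<in> M"
    using assms unfolding OS_def by (auto simp: image_subset_iff)
  have "(a * b) *\<^sub>R ((R ** S) *v x) \<in> M" if "x \<in> M" for x
    using a[OF b[OF that]]
    by (simp add: matrix_vector_mult_scaleR flip: matrix_vector_mul_assoc)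
  then show ?thesis
    using assms \<open>a > 0\<close> \<open>b > 0\<close> unfolding OS_def orthogonal_group_def
    by (auto simp: orthogonal_matrix_mul intro!: exI[of _ "a * b"])
qed

lemma OS_transpose:
  fixes M :: "(real^'d) set"
  assumes "M = int_combinations k t" "R \<in> OS M"
  shows "transpose R \<in> OS M"
proof -
  obtain a :: real where a: "a > 0" "(\<lambda>x. a *\<^sub>R (R *v x)) ` M \<subseteq> M"
    using assms(2) unfolding OS_def by blast
  have R: "orthogonal_matrix R"
    using assms(2) unfolding OS_def orthogonal_group_def by simp
  have cancel: "transpose R *v (R *v y) = y" for y
    using R by (simp add: orthogonal_matrix matrix_vector_mul_assoc)
  let ?f = "\<lambda>x. a *\<^sub>R (R *v x)"
  have "linear ?f"
    by (intro linear_compose_scale_right matrix_vector_mul_linear)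
  moreover have "inj ?f"
    using a(1) cancel by (intro injI) (metis scaleR_cancel_left less_irrefl)
  ultimately have "\<exists>m::int. m > 0 \<and> (\<forall>x\<in>M. of_int m *\<^sub>R x \<in> ?f ` M)"
    using a(2) unfolding assms(1) by (rule int_combinations_multiple_subset_image)
  then obtain m :: int where m: "m > 0" "\<And>x. x \<in> M \<Longrightarrow> of_int m *\<^sub>R x \<in> ?f ` M"
    by blast
  \<comment> \<open>Solving \<open>m x = a R y\<close> for \<open>y\<close>, with the transpose as
    inverse of \<open>R\<close>, shows that \<open>m / a\<close> is the scaling factor for the
    transpose.\<close>
  have "(of_int m / a) *\<^sub>R (transpose R *v x) \<in> M" if x: "x \<in> M" for x
  proof -
    obtain y where y: "y \<in> M" "of_int m *\<^sub>R x = a *\<^sub>R (R *v y)"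
      using m(2)[OF x] by blast
    have "(of_int m / a) *\<^sub>R (transpose R *v x) = (1 / a) *\<^sub>R (transpose R *v (of_int m *\<^sub>R x))"
      by (simp add: matrix_vector_mult_scaleR)
    also have "\<dots> = y"
      using a(1) by (simp add: y(2) matrix_vector_mult_scaleR cancel del: transpose_matrix_vector)
    finally show ?thesis
      using y(1) by simp
  qed
  then show ?thesis
    using R a(1) m(1) unfolding OS_def orthogonal_group_def
    by (auto intro!: exI[of _ "of_int m / a"])
qed

theorem theorem9:
  fixes M :: "(real^'d) set" and k :: nat
  assumes "free_Z_module k M"
  shows "subgroup (OS M) orthogonal_group"
proof
  show "OS M \<subseteq> carrier orthogonal_group"
    unfolding OS_def by blast
  show "\<one>\<^bsub>orthogonal_group\<^esub> \<in> OS M"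
    using OS_one by (simp add: orthogonal_group_def)
  show "R \<otimes>\<^bsub>orthogonal_group\<^esub> S \<in> OS M" if "R \<in> OS M" "S \<in> OS M" for R S
    using OS_mult[OF that] by (simp add: orthogonal_group_def)
  show "inv\<^bsub>orthogonal_group\<^esub> R \<in> OS M" if "R \<in> OS M" for R
  proof -
    obtain t where "M = int_combinations k t"
      using assms unfolding free_Z_module_def by blast
    then have T: "transpose R \<in> OS M"
      using OS_transpose that by blast
    \<comment> \<open>A left inverse within the carrier is the group inverse; membership of the
      transpose in the carrier comes from \<open>T\<close>.\<close>
    have "inv\<^bsub>orthogonal_group\<^esub> R = transpose R"
      using that T
      by (intro group.inv_equality[OF group_orthogonal_group])
        (auto simp: OS_def orthogonal_group_def orthogonal_matrix)
    then show ?thesis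
      using T by simp
  qed
qed

end
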